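(* Consider a $D$-dimensional spQUBO with spatial shape $\boldsymbol{L}\in\mathbb{N}^D$ whose spatial coupling function $f\colon\mathbb{Z}^D\to\mathbb{R}$ has a locality of $\boldsymbol{R}\in\mathbb{N}^D$ with $\boldsymbol{R}<\boldsymbol{L}$. Then there exists an equivalent two-dimensional periodic spQUBO with spatial volume $\prod_{k=1}^{D}(L_k+R_k)$.
   Context: Inequalities between vectors are required to hold for all elements. For $\boldsymbol{L}\in\mathbb{N}^D$ (positive entries), $[\boldsymbol{L})=\{\boldsymbol{d}\in\mathbb{Z}^D \mid \boldsymbol{0}\le\boldsymbol{d}<\boldsymbol{L}\}$. A $D$-dimensional spatial QUBO (spQUBO) is an optimization problem $$\text{maximize } F(x_1,\dots,x_N)=\frac12\sum_{i,j=1}^N c_ic_jf(\boldsymbol{d}_i-\boldsymbol{d}_j)x_ix_j+\sum_{i=1}^N b_ix_i \quad\text{subject to } x_i\in\{0,1\}\ (i=1,\dots,N),$$ where $f\colon\mathbb{Z}^D\to\mathbb{R}$ is symmetric, i.e. $f(\boldsymbol{d})=f(-\boldsymbol{d})$, each variable $x_i$ is associated with a bias $b_i\in\mathbb{R}$, a coefficient $c_i\in\mathbb{R}$ and a grid point $\boldsymbol{d}_i\in[\boldsymbol{L})$ for some $\boldsymbol{L}\in\mathbb{N}^D$, and the mapping $i\mapsto\boldsymbol{d}_i$ is injective. The function $f$ is called the spatial coupling function, $\boldsymbol{L}$ the spatial shape, and $|[\boldsymbol{L})|=\prod_{k=1}^D L_k$ the spatial volume. A function $f$ on $\mathbb{Z}^D$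 is periodic with period $\boldsymbol{L}\in\mathbb{N}^D$ if $f(\boldsymbol{d})=f(\boldsymbol{d}+\boldsymbol{k}\odot\boldsymbol{L})$ for all $\boldsymbol{d},\boldsymbol{k}\in\mathbb{Z}^D$, where $\odot$ is the element-wise product. An spQUBO is periodic if its spatial coupling function is periodic with period equal to its spatial shape. A function $f\colon\mathbb{Z}^D\to\mathbb{R}$ has a locality of $\boldsymbol{R}\in\mathbb{N}^D$ if, for every $\boldsymbol{r}\in\mathbb{Z}^D$, $|\boldsymbol{r}|\not\le\boldsymbol{R}$ implies $f(\boldsymbol{r})=0$, where $|\cdot|$ is the element-wise absolute value. Two spQUBOs (possibly of different dimensions) are equivalent if they are in the same binary variables $x_1,\dots,x_N$ and have the same objective function $F$ on $\{0,1\}^N$. *)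

theory Defs
  imports "HOL-Analysis.Analysis"
begin

text \<open>
  Vectors in \<open>\<int>\<^sup>D\<close> are \<^typ>\<open>int ^ 'd\<close> with \<open>D = CARD('d)\<close>, so that one record type covers
  spQUBOs of all dimensions \<open>D \<ge> 1\<close>. Here \<open>\<nat>\<close> means the
  positive integers, so shapes and localities are \<^typ>\<open>nat ^ 'd\<close> with \<open>positive_vec\<close> as a
  separate condition. The strict order
  of the library on \<^typ>\<open>nat ^ 'd\<close> is not the element-wise one, hence strict inequalities
  between vectors are written out per component.
\<close>

definition positive_vec :: "nat ^ 'd::finite \<Rightarrow> bool" where
  "positive_vec L \<longleftrightarrow> (\<forall>k. 0 < L $ k)"

definition grid :: "nat ^ 'd::finite \<Rightarrow> (int ^ 'd) set" where
  "grid L = {d. \<forall>k. 0 \<le> d $ k \<and> d $ k < int (L $ k)}"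

definition symmetric_fun :: "(int ^ 'd::finite \<Rightarrow> real) \<Rightarrow> bool" where
  "symmetric_fun f \<longleftrightarrow> (\<forall>d. f d = f (- d))"

definition periodic_fun :: "(int ^ 'd::finite \<Rightarrow> real) \<Rightarrow> nat ^ 'd \<Rightarrow> bool" where
  "periodic_fun f L \<longleftrightarrow> (\<forall>d k. f d = f (d + (\<chi> i. k $ i * int (L $ i))))"

definition has_locality :: "(int ^ 'd::finite \<Rightarrow> real) \<Rightarrow> nat ^ 'd \<Rightarrow> bool" where
  "has_locality f R \<longleftrightarrow> (\<forall>r. \<not> (\<forall>k. \<bar>r $ k\<bar> \<le> int (R $ k)) \<longrightarrow> f r = 0)"

text \<open>
  The variables are indexed by \<open>{1..num_vars Q}\<close>; the values of \<open>bias\<close>, \<open>coeff\<close> and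
  \<open>location\<close> outside this range are irrelevant.
\<close>

record ('d::finite) spqubo_data =
  num_vars :: nat
  shape :: "nat ^ 'd"
  coupling :: "int ^ 'd \<Rightarrow> real"
  bias :: "nat \<Rightarrow> real"
  coeff :: "nat \<Rightarrow> real"
  location :: "nat \<Rightarrow> int ^ 'd"

definition spqubo :: "'d::finite spqubo_data \<Rightarrow> bool" where
  "spqubo Q \<longleftrightarrow>
     positive_vec (shape Q) \<and>
     symmetric_fun (coupling Q) \<and>
     location Q ` {1..num_vars Q} \<subseteq> grid (shape Q) \<and>
     inj_on (location Q) {1..num_vars Q}"

definition periodic_spqubo :: "'d::finite spqubo_data \<Rightarrow> bool" where
  "periodic_spqubo Q \<longleftrightarrow> spqubo Q \<and> periodic_fun (coupling Q) (shape Q)"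

definition spatial_volume :: "'d::finite spqubo_data \<Rightarrow> nat" where
  "spatial_volume Q = card (grid (shape Q))"

definition objective :: "'d::finite spqubo_data \<Rightarrow> (nat \<Rightarrow> real) \<Rightarrow> real" where
  "objective Q x =
     1 / 2 * (\<Sum>i = 1..num_vars Q. \<Sum>j = 1..num_vars Q.
       coeff Q i * coeff Q j * coupling Q (location Q i - location Q j) * x i * x j)
     + (\<Sum>i = 1..num_vars Q. bias Q i * x i)"

definition equivalent_spqubo ::
    "'d::finite spqubo_data \<Rightarrow> 'e::finite spqubo_data \<Rightarrow> bool" where
  "equivalent_spqubo P Q \<longleftrightarrow>
     num_vars P = num_vars Q \<and>
     (\<forall>x. (\<forall>i\<in>{1..num_vars P}. x i \<in> {0, 1}) \<longrightarrow> objective P x = objective Q x)"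

end

theory Submission
  imports Defs
begin

text \<open>
  Put \<open>M\<^sub>k = L\<^sub>k + R\<^sub>k\<close> and \<open>V = \<Prod>M\<^sub>k\<close>. Reading a grid point as a mixed radix numeral with radices
  \<open>M\<^sub>k\<close> is the restriction of a linear map \<open>\<phi> : \<int>\<^sup>D \<rightarrow> \<int>/V\<close>. If \<open>\<bar>\<delta>\<^sub>k\<bar> < L\<^sub>k\<close> and \<open>\<bar>\<epsilon>\<^sub>k\<bar> \<le> R\<^sub>k\<close>, then
  \<open>\<bar>\<delta>\<^sub>k - \<epsilon>\<^sub>k\<bar> < M\<^sub>k\<close>, so \<open>\<phi> \<delta> = \<phi> \<epsilon>\<close> forces \<open>\<delta> = \<epsilon>\<close>, digit by digit. Hence pushing \<open>f\<close> forward along \<open>\<phi>\<close>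
  gives a function on \<open>\<int>/V\<close> with the same values on differences of grid points. The new shape
  is \<open>(V, 1)\<close>, so only the first coordinate carries information.
\<close>

text \<open>By induction: the inserted index becomes the lowest digit, with weight 1, and all older
  weights are scaled by its radix. Modulo that radix only the lowest digit survives, and it is too
  small to be a nonzero multiple; cancelling the radix leaves the claim for the other
  digits.\<close>

lemma mixed_radix_weights:
  fixes M :: "'a \<Rightarrow> int"
  assumes "finite S" and "\<And>k. k \<in> S \<Longrightarrow> 0 < M k"
  shows "\<exists>w. \<forall>a. (\<forall>k\<in>S. \<bar>a k\<bar> < M k) \<longrightarrow> (\<Prod>k\<in>S. M k) dvd (\<Sum>k\<in>S. a k * w k)
    \<longrightarrow> (\<forall>k\<in>S. a k = 0)"
  using assms
proof (induction S)
  case empty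
  then show ?case by simp
next
  case (insert m S)
  then obtain w where w: "\<And>a. \<lbrakk>\<forall>k\<in>S. \<bar>a k\<bar> < M k; (\<Prod>k\<in>S. M k) dvd (\<Sum>k\<in>S. a k * w k)\<rbrakk>
      \<Longrightarrow> \<forall>k\<in>S. a k = 0"
    by auto
  define w' where "w' = (\<lambda>k. if k = m then 1 else M m * w k)"
  have "\<forall>k\<in>insert m S. a k = 0"
    if small: "\<forall>k\<in>insert m S. \<bar>a k\<bar> < M k"
      and dvd: "(\<Prod>k\<in>insert m S. M k) dvd (\<Sum>k\<in>insert m S. a k * w' k)" for a
  proof -
    have "(\<Sum>k\<in>S. a k * w' k) = M m * (\<Sum>k\<in>S. a k * w k)"
      unfolding sum_distrib_left using insert.hyps
      by (intro sum.cong) (auto simp: w'_def)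
    then have *: "M m * (\<Prod>k\<in>S. M k) dvd a m + M m * (\<Sum>k\<in>S. a k * w k)"
      using dvd insert.hyps by (simp add: w'_def)
    then have "M m dvd a m"
      using dvd_add_left_iff[of "M m" "M m * _" "a m"] dvd_mult_left[OF *] by simp
    then have "a m = 0"
      using small zdvd_not_zless[of "\<bar>a m\<bar>" "M m"] by fastforce
    moreover from this have "(\<Prod>k\<in>S. M k) dvd (\<Sum>k\<in>S. a k * w k)"
      using * insert.prems[of m] by simp
    ultimately show ?thesis
      using w[of a] small by blast
  qed
  then show ?case by blast
qed

lemma card_grid: "card (grid L) = (\<Prod>k\<in>UNIV. L $ k)"
proof -
  have "grid L = vec_lambda ` (\<Pi>\<^sub>E k\<in>UNIV. {0..<int (L $ k)})"
  proof (intro equalityI subsetI)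
    fix d assume "d \<in> grid L"
    then have "vec_nth d \<in> (\<Pi>\<^sub>E k\<in>UNIV. {0..<int (L $ k)})"
      by (auto simp: grid_def)
    then show "d \<in> vec_lambda ` (\<Pi>\<^sub>E k\<in>UNIV. {0..<int (L $ k)})"
      using image_eqI[of d vec_lambda "vec_nth d"] by simp
  qed (auto simp: grid_def PiE_iff)
  moreover have "inj_on vec_lambda (\<Pi>\<^sub>E k\<in>UNIV. {0..<int (L $ k)})"
    by (simp add: inj_on_def vec_lambda_inject)
  ultimately show ?thesis
    by (simp add: card_image card_PiE)
qed

theorem theorem2:
  fixes Q :: "'d::finite spqubo_data" and R :: "nat ^ 'd"
  assumes "spqubo Q"
    and "positive_vec R"
    and "has_locality (coupling Q) R"
    and "\<forall>k. R $ k < shape Q $ k"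
  shows "\<exists>Q' :: 2 spqubo_data.
    periodic_spqubo Q' \<and> equivalent_spqubo Q Q' \<and>
    spatial_volume Q' = (\<Prod>k\<in>UNIV. (shape Q $ k + R $ k))"
proof -
  define L where "L = shape Q"
  define f where "f = coupling Q"
  define N where "N = (\<Prod>k\<in>UNIV. L $ k + R $ k)"
  define V where "V = int N"
  define box where "box = {e :: int ^ 'd. \<forall>k. \<bar>e $ k\<bar> \<le> int (R $ k)}"
  have pos: "0 < L $ k" and RL: "R $ k < L $ k" for k
    using assms by (auto simp: spqubo_def positive_vec_def L_def)
  have M_pos: "0 < int (L $ k + R $ k)" for k
    using pos[of k] by linarith
  have V_eq: "V = (\<Prod>k\<in>UNIV. int (L $ k + R $ k))"
    by (simp add: V_def N_def)
  have V_pos: "V > 0"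
    unfolding V_eq using M_pos by (intro prod_pos) blast
  have "\<exists>w. \<forall>a. (\<forall>k\<in>(UNIV :: 'd set). \<bar>a k\<bar> < int (L $ k + R $ k)) \<longrightarrow>
      V dvd (\<Sum>k\<in>UNIV. a k * w k) \<longrightarrow> (\<forall>k\<in>UNIV. a k = 0)"
    unfolding V_eq by (rule mixed_radix_weights[OF finite M_pos])
  then obtain w :: "'d \<Rightarrow> int" where w:
    "\<And>a k. \<lbrakk>\<And>k. \<bar>a k\<bar> < int (L $ k + R $ k); V dvd (\<Sum>k\<in>UNIV. a k * w k)\<rbrakk> \<Longrightarrow> a k = 0"
    by blast
  define \<phi> where "\<phi> d = (\<Sum>k\<in>UNIV. d $ k * w k)" for d :: "int ^ 'd"
  have \<phi>_diff: "\<phi> (d - e) = \<phi> d - \<phi> e" for d e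
    by (simp add: \<phi>_def left_diff_distrib sum_subtractf)
  have \<phi>_minus: "\<phi> (- d) = - \<phi> d" for d
    by (simp add: \<phi>_def sum_negf)
  have \<phi>_inj: "d = e" if "\<And>k. \<bar>d $ k\<bar> < int (L $ k)" "\<And>k. \<bar>e $ k\<bar> \<le> int (R $ k)"
    "V dvd \<phi> d - \<phi> e" for d e
  proof -
    have "\<bar>(d - e) $ k\<bar> < int (L $ k + R $ k)" for k
      using that(1,2)[of k] by simp
    moreover have "V dvd (\<Sum>k\<in>UNIV. (d - e) $ k * w k)"
      using that(3) unfolding \<phi>_diff[symmetric] unfolding \<phi>_def .
    ultimately have "(d - e) $ k = 0" for k
      by (rule w)
    then show ?thesis by (simp add: vec_eq_iff)
  qed
  have grid_diff: "\<bar>(d - e) $ k\<bar> < int (L $ k)" if "d \<in> grid L" "e \<in> grid L" for d e k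
  proof -
    have "0 \<le> d $ k" "d $ k < int (L $ k)" "0 \<le> e $ k" "e $ k < int (L $ k)"
      using that by (auto simp: grid_def)
    then show ?thesis by simp
  qed

  \<comment> \<open>By locality \<open>box\<close> contains the support of \<open>f\<close>, so this
    is the pushforward of \<open>f\<close> along \<open>\<phi>\<close> modulo \<open>V\<close>, read
    off the first coordinate.\<close>
  define g where "g v = (\<Sum>e\<in>{e\<in>box. V dvd v $ 1 - \<phi> e}. f e)" for v :: "int ^ 2"
  \<comment> \<open>Reduction modulo \<open>V\<close> keeps the first coordinate inside the shape;
    side length 1 forces 0 in the second.\<close>
  define loc :: "nat \<Rightarrow> int ^ 2"
    where "loc i = (\<chi> k. if k = 1 then \<phi> (location Q i) mod V else 0)" for i
  define Q' :: "2 spqubo_data" where "Q' =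
    \<lparr>num_vars = num_vars Q, shape = (\<chi> k. if k = 1 then N else 1), coupling = g,
     bias = bias Q, coeff = coeff Q, location = loc\<rparr>"

  have in_grid: "location Q i \<in> grid L" if "i \<in> {1..num_vars Q}" for i
    using assms(1) that by (auto simp: spqubo_def L_def)
  have g_loc: "g (loc i - loc j) = f (location Q i - location Q j)"
    if "i \<in> {1..num_vars Q}" "j \<in> {1..num_vars Q}" for i j
  proof -
    let ?d = "location Q i - location Q j"
    \<comment> \<open>Reducing both locations modulo \<open>V\<close> does not change the residue of
      their difference.\<close>
    have cong: "V dvd (loc i - loc j) $ 1 - x \<longleftrightarrow> V dvd \<phi> ?d - x" for x
      unfolding mod_eq_dvd_iff[symmetric] by (simp add: loc_def \<phi>_diff mod_diff_eq)
    have eq: "?d = e" if "e \<in> box" "V dvd \<phi> ?d - \<phi> e" for e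
      using \<phi>_inj[OF grid_diff[OF in_grid in_grid], OF \<open>i \<in> _\<close> \<open>j \<in> _\<close>] that
      unfolding box_def by blast
    \<comment> \<open>The fibre meets \<open>box\<close> at most in \<open>?d\<close> itself. If it
      is empty, the sum is 0, which is also \<open>f ?d\<close> by locality.\<close>
    have "{e\<in>box. V dvd (loc i - loc j) $ 1 - \<phi> e} = (if ?d \<in> box then {?d} else {})"
      unfolding cong by (auto dest: eq)
    moreover have "f ?d = 0" if "?d \<notin> box"
      using assms(3) that unfolding has_locality_def box_def f_def by blast
    ultimately show ?thesis by (simp add: g_def)
  qed

  have "symmetric_fun g"
    unfolding symmetric_fun_def
  proof
    fix v
    have "f (- e) = f e" for e
      using assms(1) by (simp add: spqubo_def symmetric_fun_def f_def)
    then show "g v = g (- v)"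
      unfolding g_def
      \<comment> \<open>Negation preserves \<open>box\<close> and, as \<open>\<phi>\<close> is odd,
        swaps the fibres of \<open>v\<close> and \<open>- v\<close>.\<close>
      by (intro sum.reindex_bij_witness[of _ uminus uminus])
        (auto simp: box_def \<phi>_minus dvd_diff_commute add.commute)
  qed
  moreover have "periodic_fun g (shape Q')"
    unfolding periodic_fun_def g_def
  proof (intro allI sum.cong Collect_cong conj_cong refl)
    fix v k :: "int ^ 2" and e
    have "(v + (\<chi> i. k $ i * int (shape Q' $ i))) $ 1 - \<phi> e = (v $ 1 - \<phi> e) + k $ 1 * V"
      by (simp add: Q'_def V_def)
    then show "V dvd v $ 1 - \<phi> e \<longleftrightarrow> V dvd (v + (\<chi> i. k $ i * int (shape Q' $ i))) $ 1 - \<phi> e"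
      by (simp only: dvd_add_times_triv_right_iff)
  qed
  moreover have "positive_vec (shape Q')"
    using V_pos by (simp add: positive_vec_def Q'_def V_def)
  moreover have "loc ` {1..num_vars Q} \<subseteq> grid (shape Q')"
    using V_pos by (auto simp: grid_def Q'_def loc_def V_def)
  moreover have "inj_on loc {1..num_vars Q}"
  proof (rule inj_onI)
    fix i j assume ij: "i \<in> {1..num_vars Q}" "j \<in> {1..num_vars Q}" and eq: "loc i = loc j"
    from eq have "loc i $ 1 = loc j $ 1" by simp
    \<comment> \<open>The zero vector satisfies the bound by \<open>R\<close>, so
      \<open>\<phi>_inj\<close> against 0 separates grid points.\<close>
    then have "V dvd \<phi> (location Q i - location Q j) - \<phi> 0"
      by (simp add: loc_def \<phi>_diff mod_eq_dvd_iff) (simp add: \<phi>_def)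
    then have "location Q i - location Q j = 0"
      using \<phi>_inj[OF grid_diff[OF in_grid in_grid], OF ij, of 0] by simp
    then have "location Q i = location Q j" by simp
    then show "i = j"
      using assms(1) ij unfolding spqubo_def by (blast dest: inj_onD)
  qed
  ultimately have "periodic_spqubo Q'"
    by (simp add: periodic_spqubo_def spqubo_def Q'_def)
  moreover have "equivalent_spqubo Q Q'"
    by (simp add: equivalent_spqubo_def objective_def Q'_def g_loc f_def)
  moreover have "spatial_volume Q' = (\<Prod>k\<in>UNIV. shape Q $ k + R $ k)"
    by (simp add: spatial_volume_def card_grid Q'_def N_def L_def)
  ultimately show ?thesis by blast
qed

end
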